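(* (10-fold way) Let $\mathscr C=\{\pm1\}\times\{\pm1\}$, $\phi_{\mathscr C}\colon\mathscr C\to\{\pm1\}$ the multiplication map, $\bar T=(-1,1)$ and $\bar C=(1,-1)$. A $\psi$-standard extended QM symmetry class based on a subgroup $A\subset\mathscr C$ is an isomorphism class of $\phi_{\mathscr C}|_A$-twisted extensions $1\to\mathbb T\to A^\tau\to A\to1$. (i) There is a unique such class for the trivial subgroup $A=1$. (ii) There is a unique such class for the diagonal subgroup $A=\{\pm1\}\subset\{\pm1\}\times\{\pm1\}$. (iii) There are exactly two such classes for $A=\{\pm1\}\times1$. If $T\in A^\tau$ is a lift of $\bar T$, the two classes are distinguished by $T^2=\pm1$. (iv) There are exactly two such classes for $A=1\times\{\pm1\}$, distinguished by $C^2=\pm1$, where $C\in A^\tau$ is a lift of $\bar C$. (v) There are exactly four such classes for $A=\mathscr C$, distinguished by $T^2=\pm1$ and $C^2=\pm1$, where $T,C\in A^\tau$ are lifts of $\bar T,\bar C$.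
   Context: $\mathbb T=\{z\in\mathbb C:|z|=1\}$. For a group $A$ with homomorphism $\phi\colon A\to\{\pm1\}$, a $\phi$-twisted extension of $A$ (by $\mathbb T$) is a group extension $1\to\mathbb T\to A^\tau\to A\to1$ such that for $S\in A^\tau$ over $a\in A$ and $z\in\mathbb T$: $Sz=zS$ if $\phi(a)=1$ and $Sz=\bar zS$ if $\phi(a)=-1$. Two such extensions $A^{\tau_1},A^{\tau_2}$ are isomorphic if there is a group isomorphism $A^{\tau_1}\to A^{\tau_2}$ which is the identity on $\mathbb T$ and covers the identity of $A$. Background: for a Lie group $G$ with a homomorphism $\psi=(t,c)\colon G\to\mathscr C$, an extended QM symmetry class $(G,\phi,\tau,c)$ (a $\phi$-twisted extension of $G$ together with $c$) is $\psi$-standard if $\phi=\phi_{\mathscr C}\circ\psi=tc$ and $G^\tau$ is pulled back from a $\phi_{\mathscr C}$-twisted extension of $A=\psi(G)\subset\mathscr C$; thus it is determined by $A$ and a $\phi_{\mathscr C}|_A$-twisted extension of $A$. *)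

theory Defs
  imports "HOL-Analysis.Analysis" "HOL-Algebra.Algebra"
begin

definition circle_group :: "complex monoid"
  where "circle_group = \<lparr>carrier = sphere 0 1, mult = (*), one = 1\<rparr>"

text \<open>
  The data of an extension of a group of type \<open>'a monoid\<close> by the circle group: the record itself
  is the extension group, \<open>incl\<close> the inclusion of the circle, \<open>proj\<close> the projection onto the
  quotient.
\<close>

record ('g, 'a) circle_extension = "'g monoid" +
  incl :: "complex \<Rightarrow> 'g"
  proj :: "'g \<Rightarrow> 'a"

text \<open>
  \<open>sign_img\<close> is the library's multiplicative group on \<open>{-1, 1}\<close>.
  The group \<open>A\<close> carries no topology, so extensions are extensions of abstract groups.
\<close>

locale phi_twisted_extension =
  group_hom E A "proj E"
  for A :: "'a monoid" and phi :: "'a \<Rightarrow> int" and E :: "('g, 'a) circle_extension" +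
  assumes phi_hom: "phi \<in> hom A sign_img"
    and incl_mon: "incl E \<in> mon circle_group E"
    and proj_epi: "proj E \<in> epi E A"
    and exact: "incl E ` carrier circle_group = kernel E A (proj E)"
    and linear:
      "\<And>S z. \<lbrakk>S \<in> carrier E; z \<in> carrier circle_group; phi (proj E S) = 1\<rbrakk>
        \<Longrightarrow> S \<otimes>\<^bsub>E\<^esub> incl E z = incl E z \<otimes>\<^bsub>E\<^esub> S"
    and antilinear:
      "\<And>S z. \<lbrakk>S \<in> carrier E; z \<in> carrier circle_group; phi (proj E S) = -1\<rbrakk>
        \<Longrightarrow> S \<otimes>\<^bsub>E\<^esub> incl E z = incl E (cnj z) \<otimes>\<^bsub>E\<^esub> S"

text \<open>The underlying types of the two extension groups may differ.\<close>

definition extension_iso ::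
    "('g, 'a) circle_extension \<Rightarrow> ('h, 'a) circle_extension \<Rightarrow> bool"
  where "extension_iso E F \<longleftrightarrow>
    (\<exists>f \<in> iso E F.
      (\<forall>z \<in> carrier circle_group. f (incl E z) = incl F z) \<and>
      (\<forall>S \<in> carrier E. proj F (f S) = proj E S))"

definition lifts :: "('g, 'a) circle_extension \<Rightarrow> 'a \<Rightarrow> 'g set"
  where "lifts E a = {S \<in> carrier E. proj E S = a}"

definition CT_group :: "(int \<times> int) monoid"
  where "CT_group = sign_img \<times>\<times> sign_img"

definition phi_CT :: "int \<times> int \<Rightarrow> int"
  where "phi_CT = (\<lambda>(t, c). t * c)"

definition T_bar :: "int \<times> int"
  where "T_bar = (-1, 1)"

definition C_bar :: "int \<times> int"
  where "C_bar = (1, -1)"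

definition standard_extension ::
    "(int \<times> int) set \<Rightarrow> ('g, int \<times> int) circle_extension \<Rightarrow> bool"
  where "standard_extension A E \<longleftrightarrow>
    phi_twisted_extension (CT_group\<lparr>carrier := A\<rparr>) phi_CT E"

text \<open>
  To form a set of isomorphism classes the underlying type of the extension groups has to be fixed.
  An extension of \<open>A\<close> by the circle has the cardinality of \<open>\<T> \<times> A\<close>, where \<open>\<T>\<close> is the circle, so
  for \<open>A\<close> contained in \<open>{-1, 1} \<times> {-1, 1}\<close> every extension, on whatever type, is isomorphic to one
  on the type below.
\<close>

definition symmetry_classes ::
    "(int \<times> int) set \<Rightarrow> (complex \<times> int \<times> int, int \<times> int) circle_extension set set"
  where "symmetry_classes A =
    {E. standard_extension A E} //
    {(E, F). standard_extension A E \<and> standard_extension A F \<and> extension_iso E F}"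

end

theory Submission
  imports Defs
begin

text \<open>
  An antilinear lift of an involution commutes with its own square, so the square is a real phase
  \<open>\<plusminus>1\<close>, and rescaling the lift by \<open>z\<close> multiplies the square by \<open>z * cnj z = 1\<close>; a linear lift can be
  rescaled to have any prescribed square, since \<open>\<T>\<close> has square roots. Rescaling \<open>C\<close> by a square root of the phase of the commutator of
  \<open>T\<close> and \<open>C\<close> makes \<open>T\<close> and \<open>C\<close> commute. So an extension of a subgroup of \<open>{\<plusminus>1} \<times> {\<plusminus>1}\<close> with
  \<open>T\<^sup>2 = p\<close> and \<open>C\<^sup>2 = q\<close> has a section with a cocycle that depends only on \<open>p\<close> and \<open>q\<close>, which
  determines the extension up to isomorphism, and every choice of signs is realised by the
  corresponding twisted product.
\<close>

section \<open>Signs acting on phases by conjugation, and the circle group\<close>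

definition twist :: "int \<Rightarrow> complex \<Rightarrow> complex"
  where "twist e z = (if e = 1 then z else cnj z)"

lemma twist_simps [simp]:
  "twist 1 z = z" "twist (-1) z = cnj z" "twist e 1 = 1" "twist e (-1) = -1"
  "cmod (twist e z) = cmod z"
  by (simp_all add: twist_def)

lemma twist_mult: "twist e (z * w) = twist e z * twist e w"
  by (simp add: twist_def)

lemma circle_group_simps [simp]:
  "carrier circle_group = sphere 0 1"
  "z \<otimes>\<^bsub>circle_group\<^esub> w = z * w"
  "\<one>\<^bsub>circle_group\<^esub> = 1"
  by (simp_all add: circle_group_def)

lemma circle_cnj: "cmod z = 1 \<Longrightarrow> z * cnj z = 1"
  by (simp add: complex_norm_square [symmetric])

lemma circle_sqrt:
  assumes "cmod z = 1"
  obtains w where "cmod w = 1" "w * w = z"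
proof
  show "csqrt z * csqrt z = z"
    by (metis power2_csqrt power2_eq_square)
  show "cmod (csqrt z) = 1"
    using assms by simp
qed

section \<open>Lifts and phases in a twisted extension\<close>

context phi_twisted_extension
begin

lemma incl_hom: "incl E \<in> hom circle_group E"
  using incl_mon by (simp add: mon_def)

lemma incl_closed [simp]: "cmod z = 1 \<Longrightarrow> incl E z \<in> carrier E"
  using incl_hom by (force simp: hom_def Pi_iff)

lemma incl_mult:
  "cmod z = 1 \<Longrightarrow> cmod w = 1 \<Longrightarrow> incl E z \<otimes>\<^bsub>E\<^esub> incl E w = incl E (z * w)"
  using incl_hom by (force simp: hom_def)

lemma incl_one [simp]: "incl E 1 = \<one>\<^bsub>E\<^esub>"
proof (rule G.l_cancel_one' [THEN iffD1])
  show "incl E 1 = incl E 1 \<otimes>\<^bsub>E\<^esub> incl E 1"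
    by (simp add: incl_mult)
qed auto

lemma incl_inj:
  "cmod z = 1 \<Longrightarrow> cmod w = 1 \<Longrightarrow> incl E z = incl E w \<longleftrightarrow> z = w"
  using incl_mon by (auto simp: mon_def dest: inj_onD)

lemma proj_incl [simp]: "cmod z = 1 \<Longrightarrow> proj E (incl E z) = \<one>\<^bsub>A\<^esub>"
  using exact by (auto simp: kernel_def)

lemma in_kernelE:
  assumes "S \<in> carrier E" "proj E S = \<one>\<^bsub>A\<^esub>"
  obtains z where "cmod z = 1" "S = incl E z"
proof -
  have "S \<in> incl E ` carrier circle_group"
    unfolding exact using assms by (simp add: kernel_def)
  with that show ?thesis by auto
qed

lemma phi_cases:
  assumes "a \<in> carrier A" obtains "phi a = 1" | "phi a = -1"
proof -
  have "phi a \<in> carrier sign_img"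
    using phi_hom assms by (rule hom_in_carrier)
  with that show ?thesis by (auto simp: sign_img_def)
qed

lemma incl_commute:
  assumes "S \<in> carrier E" "cmod z = 1"
  shows "S \<otimes>\<^bsub>E\<^esub> incl E z = incl E (twist (phi (proj E S)) z) \<otimes>\<^bsub>E\<^esub> S"
  by (rule phi_cases [of "proj E S"]) (use assms linear antilinear in auto)

text \<open>The quotient of two lifts of the same element lies in the kernel, which by exactness is
  the image of the circle; the fibres of \<open>proj E\<close> are torsors under phases.\<close>

lemma fibre:
  assumes "S \<in> carrier E" "S' \<in> carrier E" "proj E S = proj E S'"
  obtains z where "cmod z = 1" "S' = incl E z \<otimes>\<^bsub>E\<^esub> S"
proof -
  obtain z where "cmod z = 1" "S' \<otimes>\<^bsub>E\<^esub> inv\<^bsub>E\<^esub> S = incl E z"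
    by (rule in_kernelE [of "S' \<otimes>\<^bsub>E\<^esub> inv\<^bsub>E\<^esub> S"]) (use assms in auto)
  moreover have "S' = (S' \<otimes>\<^bsub>E\<^esub> inv\<^bsub>E\<^esub> S) \<otimes>\<^bsub>E\<^esub> S"
    using assms by (simp add: G.m_assoc)
  ultimately show ?thesis using that by metis
qed

lemma lift_exists:
  assumes "a \<in> carrier A" obtains S where "S \<in> carrier E" "proj E S = a"
proof -
  have "a \<in> proj E ` carrier E"
    using proj_epi assms by (simp add: epi_def)
  with that show ?thesis by auto
qed

text \<open>The phase \<open>w\<close> has to pass \<open>S\<close> to reach \<open>z\<close> and is
  twisted on the way. This is the multiplication rule behind the rescaling arguments below.\<close>

lemma incl_mult_mult:
  assumes "S \<in> carrier E" "S' \<in> carrier E" "cmod z = 1" "cmod w = 1"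
  shows "(incl E z \<otimes>\<^bsub>E\<^esub> S) \<otimes>\<^bsub>E\<^esub> (incl E w \<otimes>\<^bsub>E\<^esub> S')
    = incl E (z * twist (phi (proj E S)) w) \<otimes>\<^bsub>E\<^esub> (S \<otimes>\<^bsub>E\<^esub> S')"
proof -
  have "(incl E z \<otimes>\<^bsub>E\<^esub> S) \<otimes>\<^bsub>E\<^esub> (incl E w \<otimes>\<^bsub>E\<^esub> S')
      = incl E z \<otimes>\<^bsub>E\<^esub> (S \<otimes>\<^bsub>E\<^esub> incl E w) \<otimes>\<^bsub>E\<^esub> S'"
    using assms by (simp add: G.m_assoc)
  also have "\<dots> = (incl E z \<otimes>\<^bsub>E\<^esub> incl E (twist (phi (proj E S)) w)) \<otimes>\<^bsub>E\<^esub> (S \<otimes>\<^bsub>E\<^esub> S')"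
    using assms by (simp add: incl_commute [OF assms(1,4)] G.m_assoc)
  finally show ?thesis
    using assms by (simp add: incl_mult)
qed

lemma square:
  assumes "S \<in> carrier E"
  shows "S [^]\<^bsub>E\<^esub> (2::nat) = S \<otimes>\<^bsub>E\<^esub> S"
  using assms by (simp add: numeral_2_eq_2)

text \<open>The sign \<open>p\<close> is obtained before a lift is chosen: it belongs to the
  extension and to \<open>a\<close>, not to a particular lift, which makes it usable as an
  invariant.\<close>

lemma antilinear_square:
  assumes "a \<in> carrier A" "a \<otimes>\<^bsub>A\<^esub> a = \<one>\<^bsub>A\<^esub>" "phi a = -1"
  obtains p where "p \<in> {1, -1}" "\<And>S. S \<in> lifts E a \<Longrightarrow> S [^]\<^bsub>E\<^esub> (2::nat) = incl E p"
proof -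
  obtain S where S: "S \<in> carrier E" "proj E S = a"
    using assms(1) by (rule lift_exists)
  obtain p where p: "cmod p = 1" "S \<otimes>\<^bsub>E\<^esub> S = incl E p"
    by (rule in_kernelE [of "S \<otimes>\<^bsub>E\<^esub> S"]) (use S assms in auto)
  \<comment> \<open>Associativity makes \<open>S\<close> commute with its square
    \<open>incl E p\<close>, while antilinearity turns \<open>p\<close> into \<open>cnj p\<close> as
    it passes \<open>S\<close>.\<close>
  have "incl E p \<otimes>\<^bsub>E\<^esub> S = incl E (cnj p) \<otimes>\<^bsub>E\<^esub> S"
    using incl_commute [OF S(1) p(1)] S assms(3) by (simp add: G.m_assoc flip: p(2))
  then have "p = cnj p"
    using S p(1) by (subst (asm) G.r_cancel) (auto simp: incl_inj)
  with circle_cnj [OF p(1)] have "p * p = 1"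
    by simp
  then have *: "p \<in> {1, -1}"
    by (simp add: square_eq_1_iff)
  show ?thesis
  proof
    fix S' assume "S' \<in> lifts E a"
    then obtain z where z: "cmod z = 1" "S' = incl E z \<otimes>\<^bsub>E\<^esub> S"
      using S fibre [of S S'] by (auto simp: lifts_def)
    have "S' \<otimes>\<^bsub>E\<^esub> S' = incl E (z * cnj z) \<otimes>\<^bsub>E\<^esub> (S \<otimes>\<^bsub>E\<^esub> S)"
      using S z assms(3) incl_mult_mult [of S S z z] by simp
    with z S p show "S' [^]\<^bsub>E\<^esub> (2::nat) = incl E p"
      by (simp add: square circle_cnj)
  qed (use * in auto)
qed

lemma linear_normalised_lift:
  assumes "a \<in> carrier A" "a \<otimes>\<^bsub>A\<^esub> a = \<one>\<^bsub>A\<^esub>" "phi a = 1" "cmod p = 1"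
  obtains S where "S \<in> carrier E" "proj E S = a" "S \<otimes>\<^bsub>E\<^esub> S = incl E p"
proof -
  obtain S where S: "S \<in> carrier E" "proj E S = a"
    using assms(1) by (rule lift_exists)
  obtain z where z: "cmod z = 1" "S \<otimes>\<^bsub>E\<^esub> S = incl E z"
    by (rule in_kernelE [of "S \<otimes>\<^bsub>E\<^esub> S"]) (use S assms in auto)
  \<comment> \<open>\<open>cnj z\<close> is the inverse of the phase \<open>z\<close>, so
    \<open>w\<close> is a square root of the ratio of the wanted square to the present one; as
    \<open>a\<close> is linear, rescaling by \<open>w\<close> multiplies the square by
    \<open>w * w\<close>.\<close>
  obtain w where w: "cmod w = 1" "w * w = p * cnj z"
    by (rule circle_sqrt [of "p * cnj z"]) (use assms(4) z in \<open>auto simp: norm_mult\<close>)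
  show ?thesis
  proof
    have "(incl E w \<otimes>\<^bsub>E\<^esub> S) \<otimes>\<^bsub>E\<^esub> (incl E w \<otimes>\<^bsub>E\<^esub> S) = incl E (p * cnj z) \<otimes>\<^bsub>E\<^esub> incl E z"
      using S w z assms(3) incl_mult_mult [of S S w w] by simp
    also have "\<dots> = incl E (p * (z * cnj z))"
      using assms(4) z by (simp add: incl_mult norm_mult ac_simps)
    finally show "(incl E w \<otimes>\<^bsub>E\<^esub> S) \<otimes>\<^bsub>E\<^esub> (incl E w \<otimes>\<^bsub>E\<^esub> S) = incl E p"
      using z(1) by (simp add: circle_cnj)
  qed (use S w in auto)
qed

text \<open>Antilinearity of \<open>T\<close> makes the rescaling effective: past \<open>T\<close>
  the factor \<open>w\<close> becomes \<open>cnj w\<close>, and \<open>cnj w * z = w\<close> when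
  \<open>w * w = z\<close>, while in the opposite product \<open>w\<close> stays in front. For a
  linear \<open>T\<close> the commutator phase would not change.\<close>

lemma commuting_lift:
  assumes T: "T \<in> carrier E" "proj E T = a" "phi a = -1"
    and C: "C \<in> carrier E" "proj E C = b"
    and ab: "a \<otimes>\<^bsub>A\<^esub> b = b \<otimes>\<^bsub>A\<^esub> a"
  obtains C' where "C' \<in> carrier E" "proj E C' = b" "T \<otimes>\<^bsub>E\<^esub> C' = C' \<otimes>\<^bsub>E\<^esub> T"
proof -
  obtain z where z: "cmod z = 1" "T \<otimes>\<^bsub>E\<^esub> C = incl E z \<otimes>\<^bsub>E\<^esub> (C \<otimes>\<^bsub>E\<^esub> T)"
    using fibre [of "C \<otimes>\<^bsub>E\<^esub> T" "T \<otimes>\<^bsub>E\<^esub> C"] T C ab by auto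
  obtain w where w: "cmod w = 1" "w * w = z"
    using z(1) by (rule circle_sqrt)
  let ?C = "incl E w \<otimes>\<^bsub>E\<^esub> C"
  have "T \<otimes>\<^bsub>E\<^esub> ?C = incl E (cnj w) \<otimes>\<^bsub>E\<^esub> (T \<otimes>\<^bsub>E\<^esub> C)"
    using incl_mult_mult [of T C 1 w] T C w by simp
  also have "\<dots> = incl E (cnj w) \<otimes>\<^bsub>E\<^esub> incl E z \<otimes>\<^bsub>E\<^esub> (C \<otimes>\<^bsub>E\<^esub> T)"
    using T C w z by (simp add: G.m_assoc)
  also have "incl E (cnj w) \<otimes>\<^bsub>E\<^esub> incl E z = incl E (w * cnj w * w)"
    using w(1) z(1) by (simp add: incl_mult ac_simps flip: w(2))
  also have "w * cnj w * w = w"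
    using w by (simp add: circle_cnj)
  also have "incl E w \<otimes>\<^bsub>E\<^esub> (C \<otimes>\<^bsub>E\<^esub> T) = ?C \<otimes>\<^bsub>E\<^esub> T"
    using T C w by (simp add: G.m_assoc)
  finally have "T \<otimes>\<^bsub>E\<^esub> ?C = ?C \<otimes>\<^bsub>E\<^esub> T" .
  moreover have "b \<in> carrier A"
    using C by auto
  ultimately show ?thesis
    using C w by (intro that [of ?C]) auto
qed

end

section \<open>Isomorphisms of extensions and factor sets\<close>

lemma extension_isoI:
  assumes E: "phi_twisted_extension A phi E" and F: "phi_twisted_extension A phi F"
    and f: "f \<in> hom E F"
    and incl: "\<And>z. cmod z = 1 \<Longrightarrow> f (incl E z) = incl F z"
    and proj: "\<And>S. S \<in> carrier E \<Longrightarrow> proj F (f S) = proj E S"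
  shows "extension_iso E F"
proof -
  interpret E: phi_twisted_extension A phi E by fact
  interpret F: phi_twisted_extension A phi F by fact
  interpret f: group_hom E F f
    by unfold_locales (rule f)
  \<comment> \<open>Short five lemma: \<open>f\<close> is the identity on the circle and on the
    quotient, so surjectivity is checked fibre by fibre, and an element of the kernel of
    \<open>f\<close> is a phase that \<open>incl F\<close> maps to the identity.\<close>
  have "f \<in> iso E F"
    unfolding f.iso_iff
  proof (intro conjI ballI impI subsetI)
    fix S' assume S': "S' \<in> carrier F"
    obtain S where S: "S \<in> carrier E" "proj E S = proj F S'"
      by (rule E.lift_exists [of "proj F S'"]) (use S' in auto)
    obtain z where z: "cmod z = 1" "S' = incl F z \<otimes>\<^bsub>F\<^esub> f S"
      by (rule F.fibre [of "f S" S']) (use S S' proj in auto)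
    then have "S' = f (incl E z \<otimes>\<^bsub>E\<^esub> S)"
      using S by (simp add: incl)
    with S(1) z(1) show "S' \<in> f ` carrier E"
      by (metis E.G.m_closed E.incl_closed image_eqI)
  next
    fix S assume S: "S \<in> carrier E" "f S = \<one>\<^bsub>F\<^esub>"
    obtain z where z: "cmod z = 1" "S = incl E z"
      by (rule E.in_kernelE [of S]) (use S proj [of S] in auto)
    then have "incl F z = incl F 1"
      using S incl by simp
    then show "S = \<one>\<^bsub>E\<^esub>"
      using z F.incl_inj [of z 1] by simp
  qed
  then show ?thesis
    unfolding extension_iso_def using incl proj by (intro bexI [of _ f]) auto
qed

text \<open>\<open>\<omega>\<close> is the factor set of the section \<open>s\<close>. The condition
  at the identity makes the section agree there with \<open>incl E 1\<close>, so that maps defined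
  through a section are compatible with the inclusion of the circle.\<close>

definition normalised_section ::
    "('a \<Rightarrow> 'a \<Rightarrow> complex) \<Rightarrow> 'a monoid \<Rightarrow> ('g, 'a) circle_extension \<Rightarrow> ('a \<Rightarrow> 'g) \<Rightarrow> bool"
  where "normalised_section \<omega> A E s \<longleftrightarrow>
    s \<one>\<^bsub>A\<^esub> = \<one>\<^bsub>E\<^esub> \<and>
    (\<forall>a \<in> carrier A. s a \<in> carrier E \<and> proj E (s a) = a) \<and>
    (\<forall>a \<in> carrier A. \<forall>b \<in> carrier A. s a \<otimes>\<^bsub>E\<^esub> s b = incl E (\<omega> a b) \<otimes>\<^bsub>E\<^esub> s (a \<otimes>\<^bsub>A\<^esub> b))"

text \<open>Every element is uniquely a phase \<open>incl E z\<close> times some \<open>s a\<close>,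
  and in these coordinates the product is given by \<open>phi\<close> and \<open>\<omega>\<close>
  alone. The isomorphism matches elements with equal coordinates.\<close>

lemma extension_iso_if_same_cocycle:
  assumes E: "phi_twisted_extension A phi E" and F: "phi_twisted_extension A phi F"
    and s: "normalised_section \<omega> A E s" and t: "normalised_section \<omega> A F t"
    and \<omega>: "\<And>a b. a \<in> carrier A \<Longrightarrow> b \<in> carrier A \<Longrightarrow> cmod (\<omega> a b) = 1"
  shows "extension_iso E F"
proof -
  interpret E: phi_twisted_extension A phi E by fact
  interpret F: phi_twisted_extension A phi F by fact
  have s': "s a \<in> carrier E" "proj E (s a) = a" if "a \<in> carrier A" for a
    using s that by (auto simp: normalised_section_def)
  have t': "t a \<in> carrier F" "proj F (t a) = a" if "a \<in> carrier A" for a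
    using t that by (auto simp: normalised_section_def)
  \<comment> \<open>\<open>THE\<close> picks the phase coordinate of \<open>S\<close>: it exists by
    \<open>fibre\<close> and is unique because \<open>s (proj E S)\<close> cancels and
    \<open>incl E\<close> is injective.\<close>
  define f where "f S = incl F (THE z. cmod z = 1 \<and> S = incl E z \<otimes>\<^bsub>E\<^esub> s (proj E S)) \<otimes>\<^bsub>F\<^esub> t (proj E S)" for S
  have f: "f (incl E z \<otimes>\<^bsub>E\<^esub> s a) = incl F z \<otimes>\<^bsub>F\<^esub> t a" if a: "a \<in> carrier A" and z: "cmod z = 1" for a z
  proof -
    have "(THE w. cmod w = 1 \<and> incl E z \<otimes>\<^bsub>E\<^esub> s a = incl E w \<otimes>\<^bsub>E\<^esub> s a) = z"
      by (rule the_equality) (use a z s' in \<open>auto simp: E.incl_inj\<close>)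
    with a z s' show ?thesis
      by (simp add: f_def)
  qed
  have decomp: "\<exists>z a. cmod z = 1 \<and> a \<in> carrier A \<and> S = incl E z \<otimes>\<^bsub>E\<^esub> s a" if S: "S \<in> carrier E" for S
  proof -
    obtain z where "cmod z = 1" "S = incl E z \<otimes>\<^bsub>E\<^esub> s (proj E S)"
      by (rule E.fibre [of "s (proj E S)" S]) (use S s' in auto)
    moreover have "proj E S \<in> carrier A"
      using S by simp
    ultimately show ?thesis by metis
  qed
  show ?thesis
  proof (rule extension_isoI [OF E F, of f])
    show "f \<in> hom E F"
    proof (rule homI)
      fix S assume "S \<in> carrier E"
      with decomp obtain z a where "cmod z = 1" "a \<in> carrier A" "S = incl E z \<otimes>\<^bsub>E\<^esub> s a"
        by metis
      then show "f S \<in> carrier F"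
        using t' by (simp add: f)
    next
      fix S S' assume "S \<in> carrier E" "S' \<in> carrier E"
      with decomp obtain z a w b where
        S: "cmod z = 1" "a \<in> carrier A" "S = incl E z \<otimes>\<^bsub>E\<^esub> s a" and
        S': "cmod w = 1" "b \<in> carrier A" "S' = incl E w \<otimes>\<^bsub>E\<^esub> s b"
        by metis
      \<comment> \<open>Phase coordinate of the product: \<open>w\<close> is twisted in passing
        \<open>s a\<close>, and merging \<open>s a\<close> with \<open>s b\<close> contributes
        \<open>\<omega> a b\<close>.\<close>
      let ?u = "z * twist (phi a) w * \<omega> a b"
      have u: "cmod ?u = 1"
        using S S' \<omega> by (simp add: norm_mult)
      have "S \<otimes>\<^bsub>E\<^esub> S' = incl E (z * twist (phi a) w) \<otimes>\<^bsub>E\<^esub> (s a \<otimes>\<^bsub>E\<^esub> s b)"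
        using S S' s' by (simp add: E.incl_mult_mult)
      also have "s a \<otimes>\<^bsub>E\<^esub> s b = incl E (\<omega> a b) \<otimes>\<^bsub>E\<^esub> s (a \<otimes>\<^bsub>A\<^esub> b)"
        using s S S' by (simp add: normalised_section_def)
      also have "incl E (z * twist (phi a) w) \<otimes>\<^bsub>E\<^esub> \<dots> = incl E ?u \<otimes>\<^bsub>E\<^esub> s (a \<otimes>\<^bsub>A\<^esub> b)"
        using S(1,2) S'(1,2) s'(1) [of "a \<otimes>\<^bsub>A\<^esub> b"] \<omega> [of a b]
        by (simp add: norm_mult E.incl_mult flip: E.G.m_assoc)
      finally have "f (S \<otimes>\<^bsub>E\<^esub> S') = incl F ?u \<otimes>\<^bsub>F\<^esub> t (a \<otimes>\<^bsub>A\<^esub> b)"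
        using f [OF _ u] S S' by simp
      also have "\<dots> = incl F (z * twist (phi a) w) \<otimes>\<^bsub>F\<^esub> (incl F (\<omega> a b) \<otimes>\<^bsub>F\<^esub> t (a \<otimes>\<^bsub>A\<^esub> b))"
        using S(1,2) S'(1,2) t'(1) [of "a \<otimes>\<^bsub>A\<^esub> b"] \<omega> [of a b]
        by (simp add: norm_mult F.incl_mult flip: F.G.m_assoc)
      also have "incl F (\<omega> a b) \<otimes>\<^bsub>F\<^esub> t (a \<otimes>\<^bsub>A\<^esub> b) = t a \<otimes>\<^bsub>F\<^esub> t b"
        using t S S' by (simp add: normalised_section_def)
      also have "incl F (z * twist (phi a) w) \<otimes>\<^bsub>F\<^esub> \<dots> = f S \<otimes>\<^bsub>F\<^esub> f S'"
        using S S' t' by (simp add: f F.incl_mult_mult)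
      finally show "f (S \<otimes>\<^bsub>E\<^esub> S') = f S \<otimes>\<^bsub>F\<^esub> f S'" .
    qed
  next
    fix z :: complex assume z: "cmod z = 1"
    with f [of "\<one>\<^bsub>A\<^esub>" z] s t show "f (incl E z) = incl F z"
      by (simp add: normalised_section_def)
  next
    fix S assume "S \<in> carrier E"
    with decomp obtain z a where "cmod z = 1" "a \<in> carrier A" "S = incl E z \<otimes>\<^bsub>E\<^esub> s a"
      by metis
    then show "proj F (f S) = proj E S"
      using s' t' by (simp add: f)
  qed
qed

section \<open>Counting classes with a complete invariant\<close>

lemma quotient_by_invariant:
  fixes U :: "'x set" and R :: "'x \<Rightarrow> 'x \<Rightarrow> bool" and Q :: "'i \<Rightarrow> 'x \<Rightarrow> bool"
  defines "r \<equiv> {(x, y). x \<in> U \<and> y \<in> U \<and> R x y}"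
  assumes ex: "\<And>i. i \<in> I \<Longrightarrow> \<exists>x \<in> U. Q i x"
    and inv: "\<And>x. x \<in> U \<Longrightarrow> \<exists>!i \<in> I. Q i x"
    and R: "\<And>i x y. i \<in> I \<Longrightarrow> x \<in> U \<Longrightarrow> y \<in> U \<Longrightarrow> Q i x \<Longrightarrow> R x y \<longleftrightarrow> Q i y"
  shows "card (U // r) = card I" "\<forall>i \<in> I. \<exists>!K \<in> U // r. \<forall>x \<in> K. Q i x"
proof -
  define K where "K i = {x \<in> U. Q i x}" for i
  \<comment> \<open>Being related to an element of value \<open>i\<close> amounts to having value
    \<open>i\<close>, so the classes are the level sets of the invariant.\<close>
  have class_eq: "r `` {x} = K i" if "i \<in> I" "x \<in> U" "Q i x" for i x
    using that R [of i x] by (auto simp: r_def K_def)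
  have classes: "U // r = K ` I"
  proof (intro equalityI subsetI)
    fix Z assume "Z \<in> U // r"
    then obtain x where x: "x \<in> U" "Z = r `` {x}"
      by (auto elim: quotientE)
    with inv obtain i where "i \<in> I" "Q i x"
      by blast
    with x class_eq show "Z \<in> K ` I" by auto
  next
    fix Z assume "Z \<in> K ` I"
    then obtain i where i: "i \<in> I" "Z = K i" by auto
    with ex obtain x where "x \<in> U" "Q i x" by blast
    with i class_eq show "Z \<in> U // r"
      by (metis quotientI)
  qed
  \<comment> \<open>Level sets are nonempty by \<open>ex\<close>, so a class cannot satisfy
    \<open>Q j\<close> vacuously. This yields both the injectivity of \<open>K\<close> and the
    uniqueness of the class with a given value.\<close>
  have K_eq: "i = j" if i: "i \<in> I" and j: "j \<in> I" and Q: "\<forall>x \<in> K i. Q j x" for i j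
  proof -
    obtain x where "x \<in> U" "Q i x" using ex i by blast
    with i j Q inv [of x] show ?thesis by (auto simp: K_def)
  qed
  have "inj_on K I"
    by (rule inj_onI) (use K_eq in \<open>auto simp: K_def\<close>)
  then show "card (U // r) = card I"
    unfolding classes by (rule card_image)
  show "\<forall>i \<in> I. \<exists>!K \<in> U // r. \<forall>x \<in> K. Q i x"
  proof
    fix i assume i: "i \<in> I"
    show "\<exists>!Z \<in> U // r. \<forall>x \<in> Z. Q i x"
    proof (rule ex1I [of _ "K i"])
      show "K i \<in> U // r \<and> (\<forall>x \<in> K i. Q i x)"
        using i by (auto simp: classes K_def)
    next
      fix Z assume "Z \<in> U // r \<and> (\<forall>x \<in> Z. Q i x)"
      with i K_eq show "Z = K i"
        by (auto simp: classes)
    qed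
  qed
qed

section \<open>The group \<open>CT_group\<close> and its subgroups\<close>

lemma CT_group_simps [simp]:
  "carrier CT_group = {-1, 1} \<times> {-1, 1}"
  "(t, c) \<otimes>\<^bsub>CT_group\<^esub> (t', c') = (t * t', c * c')"
  "\<one>\<^bsub>CT_group\<^esub> = (1, 1)"
  by (auto simp: CT_group_def sign_img_def)

lemma phi_CT_simps [simp]: "phi_CT (t, c) = t * c" "phi_CT T_bar = -1" "phi_CT C_bar = -1"
  by (simp_all add: phi_CT_def T_bar_def C_bar_def)

lemma CT_group: "group CT_group"
  by (rule groupI) auto

text \<open>Every element of \<open>CT_group\<close> is its own inverse, so closure under inverses
  is automatic.\<close>

lemma CT_subgroupI:
  assumes "(1, 1) \<in> A" "A \<subseteq> {-1, 1} \<times> {-1, 1}"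
    and "\<And>t c t' c'. (t, c) \<in> A \<Longrightarrow> (t', c') \<in> A \<Longrightarrow> (t * t', c * c') \<in> A"
  shows "subgroup A CT_group"
proof (rule group.subgroupI [OF CT_group])
  fix a assume a: "a \<in> A"
  then have "a \<otimes>\<^bsub>CT_group\<^esub> a = \<one>\<^bsub>CT_group\<^esub>" "a \<in> carrier CT_group"
    using assms(2) by auto
  then have "inv\<^bsub>CT_group\<^esub> a = a"
    by (simp add: CT_group group.inv_equality)
  with a show "inv\<^bsub>CT_group\<^esub> a \<in> A"
    by simp
qed (use assms in auto)

lemma CT_subgroups:
  "subgroup {(1, 1)} CT_group" "subgroup {(1, 1), (-1, -1)} CT_group"
  "subgroup ({1, -1} \<times> {1}) CT_group" "subgroup ({1} \<times> {1, -1}) CT_group"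
  "subgroup (carrier CT_group) CT_group"
  by (rule CT_subgroupI; auto)+

text \<open>The product of two distinct nontrivial elements is the third, so a subgroup containing
  two of them is everything. The two-element cases are listed by their generator, as
  \<open>order_2_section\<close> expects.\<close>

lemma CT_subgroup_cases:
  assumes "subgroup A CT_group"
  obtains "A = {(1, 1)}" | "A = {(1, 1), (-1, -1)}" | "A = {(1, 1), T_bar}" | "A = {(1, 1), C_bar}"
    | "A = carrier CT_group"
proof -
  have sub: "A \<subseteq> {(1, 1), T_bar, C_bar, (-1, -1)}"
    using subgroup.subset [OF assms] by (auto simp: T_bar_def C_bar_def)
  have one: "(1, 1) \<in> A"
    using subgroup.one_closed [OF assms] by simp
  have "T_bar \<otimes>\<^bsub>CT_group\<^esub> C_bar = (-1, -1)" "T_bar \<otimes>\<^bsub>CT_group\<^esub> (-1, -1) = C_bar"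
    "C_bar \<otimes>\<^bsub>CT_group\<^esub> (-1, -1) = T_bar"
    by (simp_all add: T_bar_def C_bar_def)
  then have closed: "T_bar \<in> A \<Longrightarrow> C_bar \<in> A \<Longrightarrow> (-1, -1) \<in> A"
    "T_bar \<in> A \<Longrightarrow> (-1, -1) \<in> A \<Longrightarrow> C_bar \<in> A" "C_bar \<in> A \<Longrightarrow> (-1, -1) \<in> A \<Longrightarrow> T_bar \<in> A"
    using subgroup.m_closed [OF assms] by metis+
  have full: "carrier CT_group = {(1, 1), T_bar, C_bar, (-1, -1)}"
    by (auto simp: T_bar_def C_bar_def)
  show ?thesis
  proof (cases "T_bar \<in> A"; cases "C_bar \<in> A")
    assume "T_bar \<in> A" "C_bar \<in> A"
    with sub one closed(1) have "A = carrier CT_group"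
      unfolding full by blast
    then show ?thesis by (rule that)
  next
    assume *: "T_bar \<in> A" "C_bar \<notin> A"
    with closed(2) have "(-1, -1) \<notin> A" by blast
    with * sub one have "A = {(1, 1), T_bar}" by blast
    then show ?thesis by (rule that)
  next
    assume *: "T_bar \<notin> A" "C_bar \<in> A"
    with closed(3) have "(-1, -1) \<notin> A" by blast
    with * sub one have "A = {(1, 1), C_bar}" by blast
    then show ?thesis by (rule that)
  next
    assume *: "T_bar \<notin> A" "C_bar \<notin> A"
    show ?thesis
    proof (cases "(-1, -1) \<in> A")
      case True
      with * sub one have "A = {(1, 1), (-1, -1)}" by blast
      then show ?thesis by (rule that)
    next
      case False
      with * sub one have "A = {(1, 1)}" by blast
      then show ?thesis by (rule that)
    qed
  qed
qed

section \<open>Model extensions with prescribed squares\<close>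

definition sign_cocycle :: "complex \<Rightarrow> int \<Rightarrow> int \<Rightarrow> complex"
  where "sign_cocycle p t t' = (if t = -1 \<and> t' = -1 then p else 1)"

lemma sign_cocycle_assoc:
  assumes "t \<in> {-1, 1}" "t' \<in> {-1, 1}" "t'' \<in> {-1, 1}"
  shows "sign_cocycle p t t' * sign_cocycle p (t * t') t'' = sign_cocycle p t' t'' * sign_cocycle p t (t' * t'')"
  using assms by (elim insertE emptyE) (simp_all add: sign_cocycle_def)

text \<open>\<open>sign_cocycle p\<close> is the factor set of the section consisting of the
  identity and an element with square \<open>p\<close>. The product of two such is the factor set of
  the section 1, \<open>T\<close>, \<open>C\<close>, \<open>TC\<close> for commuting
  \<open>T\<close> and \<open>C\<close> whose squares are the signs \<open>p\<close> and
  \<open>q\<close>.\<close>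

definition CT_cocycle :: "complex \<Rightarrow> complex \<Rightarrow> int \<times> int \<Rightarrow> int \<times> int \<Rightarrow> complex"
  where "CT_cocycle p q = (\<lambda>(t, c) (t', c'). sign_cocycle p t t' * sign_cocycle q c c')"

text \<open>A pair of \<open>z\<close> and \<open>a\<close> stands for the phase \<open>z\<close>
  times the section at \<open>a\<close>. One formula serves all subgroups \<open>A\<close>, with the
  factor set restricted to \<open>A\<close>.\<close>

definition CT_model ::
    "(int \<times> int) set \<Rightarrow> complex \<Rightarrow> complex \<Rightarrow> (complex \<times> int \<times> int, int \<times> int) circle_extension"
  where "CT_model A p q =
    \<lparr>carrier = sphere 0 1 \<times> A,
     mult = (\<lambda>(z, a) (w, b). (z * twist (phi_CT a) w * CT_cocycle p q a b, a \<otimes>\<^bsub>CT_group\<^esub> b)),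
     one = (1, 1, 1),
     incl = (\<lambda>z. (z, 1, 1)),
     proj = snd\<rparr>"

lemma CT_model_simps [simp]:
  "carrier (CT_model A p q) = sphere 0 1 \<times> A"
  "(z, t, c) \<otimes>\<^bsub>CT_model A p q\<^esub> (w, t', c') =
    (z * twist (t * c) w * CT_cocycle p q (t, c) (t', c'), t * t', c * c')"
  "\<one>\<^bsub>CT_model A p q\<^esub> = (1, 1, 1)"
  "incl (CT_model A p q) = (\<lambda>z. (z, 1, 1))"
  "proj (CT_model A p q) = snd"
  by (simp_all add: CT_model_def)

lemma norm_CT_cocycle: "p \<in> {1, -1} \<Longrightarrow> q \<in> {1, -1} \<Longrightarrow> cmod (CT_cocycle p q a b) = 1"
  by (auto simp: CT_cocycle_def sign_cocycle_def norm_mult split: prod.splits)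

lemma CT_cocycle_one [simp]:
  "CT_cocycle p q (1, 1) (t, c) = 1" "CT_cocycle p q (t, c) (1, 1) = 1"
  by (simp_all add: CT_cocycle_def sign_cocycle_def)

lemma group_CT_model:
  assumes A: "subgroup A CT_group" and p: "p \<in> {1, -1}" and q: "q \<in> {1, -1}"
  shows "group (CT_model A p q)"
proof (rule groupI)
  have closed: "(t * t', c * c') \<in> A" if "(t, c) \<in> A" "(t', c') \<in> A" for t c t' c'
    using subgroup.m_closed [OF A that] by simp
  have sub: "t \<in> {-1, 1} \<and> c \<in> {-1, 1}" if "(t, c) \<in> A" for t c
    using subgroup.subset [OF A] that by auto
  have one: "(1, 1) \<in> A"
    using subgroup.one_closed [OF A] by simp
  let ?M = "CT_model A p q"
  show "\<one>\<^bsub>?M\<^esub> \<in> carrier ?M"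
    using one by simp
  fix x assume x: "x \<in> carrier ?M"
  then obtain z t c where x': "x = (z, t, c)" "cmod z = 1" "(t, c) \<in> A"
    by (cases x) auto
  show "\<one>\<^bsub>?M\<^esub> \<otimes>\<^bsub>?M\<^esub> x = x"
    using x' by simp
  \<comment> \<open>Left inverse of \<open>x\<close>: \<open>(t, c)\<close> is its own inverse,
    \<open>twist (t * c) (cnj z)\<close> cancels the twisted \<open>z\<close>, and the cocycle value
    is a sign, hence its own inverse.\<close>
  have "cmod (CT_cocycle p q (t, c) (t, c) * twist (t * c) (cnj z)) = 1"
    using x' p q by (simp add: norm_mult norm_CT_cocycle)
  moreover have "(CT_cocycle p q (t, c) (t, c) * twist (t * c) (cnj z), t, c) \<otimes>\<^bsub>?M\<^esub> x = (1, 1, 1)"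
    using sub [OF x'(3)] x' p q circle_cnj [OF x'(2)]
    by (auto simp: CT_cocycle_def sign_cocycle_def twist_def ac_simps)
  ultimately show "\<exists>y \<in> carrier ?M. y \<otimes>\<^bsub>?M\<^esub> x = \<one>\<^bsub>?M\<^esub>"
    using x' by (intro bexI [of _ "(CT_cocycle p q (t, c) (t, c) * twist (t * c) (cnj z), t, c)"]) auto
  fix y assume "y \<in> carrier ?M"
  then obtain w t' c' where y: "y = (w, t', c')" "cmod w = 1" "(t', c') \<in> A"
    by (cases y) auto
  show "x \<otimes>\<^bsub>?M\<^esub> y \<in> carrier ?M"
    using x' y p q closed by (simp add: norm_mult norm_CT_cocycle)
  fix u assume "u \<in> carrier ?M"
  then obtain v t'' c'' where u: "u = (v, t'', c'')" "cmod v = 1" "(t'', c'') \<in> A"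
    by (cases u) auto
  have cocycle: "CT_cocycle p q (t, c) (t', c') * CT_cocycle p q (t * t', c * c') (t'', c'')
      = CT_cocycle p q (t', c') (t'', c'') * CT_cocycle p q (t, c) (t' * t'', c' * c'')"
  proof -
    have "sign_cocycle p t t' * sign_cocycle p (t * t') t'' = sign_cocycle p t' t'' * sign_cocycle p t (t' * t'')"
      "sign_cocycle q c c' * sign_cocycle q (c * c') c'' = sign_cocycle q c' c'' * sign_cocycle q c (c' * c'')"
      using sub [OF x'(3)] sub [OF y(3)] sub [OF u(3)] by (simp_all only: sign_cocycle_assoc)
    from arg_cong2 [OF this, of "(*)"] show ?thesis
      by (simp add: CT_cocycle_def ac_simps)
  qed
  \<comment> \<open>The cocycle takes the values \<plusminus>1, which conjugation fixes, so the
    twisted cocycle identity behind associativity reduces to the untwisted one.\<close>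
  have twist_cocycle: "twist e (CT_cocycle p q a b) = CT_cocycle p q a b" for e a b
    using p q by (auto simp: CT_cocycle_def sign_cocycle_def twist_def split: prod.splits)
  have twist_twist: "twist (t * t' * (c * c')) v = twist (t * c) (twist (t' * c') v)"
    using sub [OF x'(3)] sub [OF y(3)] by (auto simp: twist_def)
  show "x \<otimes>\<^bsub>?M\<^esub> y \<otimes>\<^bsub>?M\<^esub> u = x \<otimes>\<^bsub>?M\<^esub> (y \<otimes>\<^bsub>?M\<^esub> u)"
    using x' y u
    by (simp add: twist_mult twist_cocycle flip: twist_twist) (use cocycle in \<open>simp add: ac_simps\<close>)
qed

lemma standard_CT_model:
  assumes A: "subgroup A CT_group" and p: "p \<in> {1, -1}" and q: "q \<in> {1, -1}"
  shows "standard_extension A (CT_model A p q)"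
proof -
  let ?A = "CT_group\<lparr>carrier := A\<rparr>" and ?M = "CT_model A p q"
  have sub: "t \<in> {-1, 1} \<and> c \<in> {-1, 1}" if "(t, c) \<in> A" for t c
    using subgroup.subset [OF A] that by auto
  have one: "(1, 1) \<in> A"
    using subgroup.one_closed [OF A] by simp
  interpret A: group ?A
    by (rule subgroup.subgroup_is_group [OF A CT_group])
  interpret M: group ?M
    using assms by (rule group_CT_model)
  have hom: "snd \<in> hom ?M ?A"
    by (rule homI) auto
  have "phi_twisted_extension ?A phi_CT ?M"
  proof unfold_locales
    show "proj ?M \<in> hom ?M ?A"
      using hom by simp
    show "phi_CT \<in> hom ?A sign_img"
      by (rule homI) (auto simp: sign_img_def dest!: sub)
    show "incl ?M \<in> mon circle_group ?M"
      using one by (auto simp: mon_def hom_def inj_on_def norm_mult)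
    show "proj ?M \<in> epi ?M ?A"
      using hom by (force simp: epi_def intro!: image_eqI [of _ _ "(1, _)"])
    show "incl ?M ` carrier circle_group = kernel ?M ?A (proj ?M)"
      using one by (auto simp: kernel_def)
  next
    fix S z assume "S \<in> carrier ?M" "z \<in> carrier circle_group" "phi_CT (proj ?M S) = 1"
    then show "S \<otimes>\<^bsub>?M\<^esub> incl ?M z = incl ?M z \<otimes>\<^bsub>?M\<^esub> S"
      by (cases S) (auto simp: ac_simps)
  next
    fix S z assume "S \<in> carrier ?M" "z \<in> carrier circle_group" "phi_CT (proj ?M S) = -1"
    then show "S \<otimes>\<^bsub>?M\<^esub> incl ?M z = incl ?M (cnj z) \<otimes>\<^bsub>?M\<^esub> S"
      by (cases S) (auto simp: ac_simps)
  qed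
  then show ?thesis
    by (simp add: standard_extension_def)
qed

section \<open>The square of a lift as an isomorphism invariant\<close>

definition lift_square :: "'a \<Rightarrow> complex \<Rightarrow> ('g, 'a) circle_extension \<Rightarrow> bool"
  where "lift_square a p E \<longleftrightarrow> (\<forall>S \<in> lifts E a. S [^]\<^bsub>E\<^esub> (2::nat) = incl E p)"

text \<open>A lift of \<open>T_bar\<close> with phase \<open>z\<close> has square phase
  \<open>z * cnj z * p = p\<close>, and likewise for \<open>C_bar\<close> and \<open>q\<close>. If
  the element is not in \<open>A\<close>, there are no lifts to check.\<close>

lemma CT_model_lift_square:
  assumes "subgroup A CT_group" "p \<in> {1, -1}" "q \<in> {1, -1}"
  shows "lift_square T_bar p (CT_model A p q)" "lift_square C_bar q (CT_model A p q)"
proof -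
  interpret phi_twisted_extension "CT_group\<lparr>carrier := A\<rparr>" phi_CT "CT_model A p q"
    using standard_CT_model [OF assms] by (simp add: standard_extension_def)
  show "lift_square T_bar p (CT_model A p q)" "lift_square C_bar q (CT_model A p q)"
    by (auto simp: lift_square_def lifts_def square T_bar_def C_bar_def CT_cocycle_def sign_cocycle_def circle_cnj)
qed

text \<open>An isomorphism covering the identity maps the lifts of \<open>a\<close> onto the lifts
  of \<open>a\<close>, and it preserves squares and phases.\<close>

lemma lift_square_iso:
  assumes E: "phi_twisted_extension A phi E" and F: "phi_twisted_extension A phi F"
    and iso: "extension_iso E F" and p: "cmod p = 1" and sq: "lift_square a p E"
  shows "lift_square a p F"
proof -
  interpret E: phi_twisted_extension A phi E by fact
  interpret F: phi_twisted_extension A phi F by fact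
  obtain f where f: "f \<in> iso E F" and incl: "\<And>z. cmod z = 1 \<Longrightarrow> f (incl E z) = incl F z"
    and proj: "\<And>S. S \<in> carrier E \<Longrightarrow> proj F (f S) = proj E S"
    using iso unfolding extension_iso_def by auto
  have hom: "f \<in> hom E F" and surj: "f ` carrier E = carrier F"
    using f by (auto simp: iso_def bij_betw_def)
  show ?thesis
    unfolding lift_square_def
  proof
    fix S' assume "S' \<in> lifts F a"
    then have S': "S' \<in> f ` carrier E" "proj F S' = a"
      by (simp_all add: lifts_def surj)
    then obtain S where S: "S' = f S" "S \<in> carrier E"
      by blast
    with S' proj have "S \<in> lifts E a"
      by (simp add: lifts_def)
    from S have "S' [^]\<^bsub>F\<^esub> (2::nat) = f (S [^]\<^bsub>E\<^esub> (2::nat))"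
      using hom by (simp add: E.square F.square hom_mult hom_in_carrier [OF hom])
    with \<open>S \<in> lifts E a\<close> S sq p show "S' [^]\<^bsub>F\<^esub> (2::nat) = incl F p"
      by (simp add: lift_square_def incl)
  qed
qed

context phi_twisted_extension
begin

lemma lifts_nonempty: "a \<in> carrier A \<Longrightarrow> lifts E a \<noteq> {}"
  by (erule lift_exists) (auto simp: lifts_def)

lemma lift_square_unique:
  assumes "a \<in> carrier A" "cmod p = 1" "cmod q = 1" "lift_square a p E" "lift_square a q E"
  shows "p = q"
proof -
  obtain S where "S \<in> lifts E a"
    using lifts_nonempty [OF assms(1)] by blast
  then have "incl E p = incl E q"
    using assms(4,5) by (metis lift_square_def)
  with assms(2,3) show ?thesis
    by (simp add: incl_inj)
qed

section \<open>Sections with the model cocycle\<close>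

lemma order_2_section:
  assumes "carrier A = {\<one>\<^bsub>A\<^esub>, a}" "a \<noteq> \<one>\<^bsub>A\<^esub>" "a \<otimes>\<^bsub>A\<^esub> a = \<one>\<^bsub>A\<^esub>"
    and "S \<in> carrier E" "proj E S = a" "S \<otimes>\<^bsub>E\<^esub> S = incl E (\<omega> a a)" "cmod (\<omega> a a) = 1"
    and "\<omega> \<one>\<^bsub>A\<^esub> \<one>\<^bsub>A\<^esub> = 1" "\<omega> \<one>\<^bsub>A\<^esub> a = 1" "\<omega> a \<one>\<^bsub>A\<^esub> = 1"
  shows "\<exists>s. normalised_section \<omega> A E s"
proof
  \<comment> \<open>Of the four products of values of this section, only \<open>S\<close> times
    \<open>S\<close> is not covered by the unit laws.\<close>
  show "normalised_section \<omega> A E (\<lambda>b. if b = \<one>\<^bsub>A\<^esub> then \<one>\<^bsub>E\<^esub> else S)"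
    using assms H.l_one [of a] H.r_one [of a] by (auto simp: normalised_section_def)
qed

end

text \<open>\<open>T\<close> and \<open>C\<close> commute and their squares are signs, hence
  central. So a product of two values of the section can be sorted into a phase, then
  \<open>T\<close>, then \<open>C\<close>, and the phase that appears is the model cocycle.\<close>

lemma CT_section_full:
  assumes E: "phi_twisted_extension CT_group phi E" and p: "p \<in> {1, -1}" and q: "q \<in> {1, -1}"
    and T: "T \<in> carrier E" "proj E T = T_bar" "T \<otimes>\<^bsub>E\<^esub> T = incl E p"
    and C: "C \<in> carrier E" "proj E C = C_bar" "C \<otimes>\<^bsub>E\<^esub> C = incl E q"
    and TC: "T \<otimes>\<^bsub>E\<^esub> C = C \<otimes>\<^bsub>E\<^esub> T"
  shows "normalised_section (CT_cocycle p q) CT_group E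
    (\<lambda>(t, c). (if t = -1 then T else \<one>\<^bsub>E\<^esub>) \<otimes>\<^bsub>E\<^esub> (if c = -1 then C else \<one>\<^bsub>E\<^esub>))"
proof -
  interpret phi_twisted_extension CT_group phi E by fact
  \<comment> \<open>A sign is real, so it commutes even with antilinear lifts.\<close>
  have central: "S \<otimes>\<^bsub>E\<^esub> incl E r = incl E r \<otimes>\<^bsub>E\<^esub> S" if "S \<in> carrier E" "r \<in> {1, -1}" for S r
    using incl_commute [OF that(1), of r] that(2) by auto
  have norm: "cmod p = 1" "cmod q = 1"
    using p q by auto
  have central_left: "S \<otimes>\<^bsub>E\<^esub> (incl E r \<otimes>\<^bsub>E\<^esub> S') = incl E r \<otimes>\<^bsub>E\<^esub> (S \<otimes>\<^bsub>E\<^esub> S')"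
    if "S \<in> carrier E" "S' \<in> carrier E" "r \<in> {1, -1}" for S S' r
    using central [OF that(1,3)] that by (auto simp flip: G.m_assoc)
  have left: "T \<otimes>\<^bsub>E\<^esub> (T \<otimes>\<^bsub>E\<^esub> S) = incl E p \<otimes>\<^bsub>E\<^esub> S" "C \<otimes>\<^bsub>E\<^esub> (C \<otimes>\<^bsub>E\<^esub> S) = incl E q \<otimes>\<^bsub>E\<^esub> S"
    "C \<otimes>\<^bsub>E\<^esub> (T \<otimes>\<^bsub>E\<^esub> S) = T \<otimes>\<^bsub>E\<^esub> (C \<otimes>\<^bsub>E\<^esub> S)"
    if "S \<in> carrier E" for S
    using T C TC that by (simp_all flip: G.m_assoc)
  have pq: "incl E (p * q) = incl E p \<otimes>\<^bsub>E\<^esub> incl E q"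
    using norm by (simp add: incl_mult)
  show ?thesis
    unfolding normalised_section_def
    using T C norm
    by (auto simp: CT_cocycle_def sign_cocycle_def T_bar_def C_bar_def pq G.m_assoc left TC [symmetric]
      central [OF T(1) p] central [OF T(1) q] central [OF _ p] central_left [OF T(1) _ q])
qed

text \<open>The two signs fix the factor set: subgroup by subgroup, lifts are adjusted until they
  multiply as in the model.\<close>

lemma standard_section:
  assumes E: "standard_extension A E" and A: "subgroup A CT_group"
    and p: "p \<in> {1, -1}" and q: "q \<in> {1, -1}"
    and sq: "lift_square T_bar p E" "lift_square C_bar q E"
  shows "\<exists>s. normalised_section (CT_cocycle p q) (CT_group\<lparr>carrier := A\<rparr>) E s"
proof -
  interpret phi_twisted_extension "CT_group\<lparr>carrier := A\<rparr>" phi_CT E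
    using E by (simp add: standard_extension_def)
  have norm: "cmod p = 1" "cmod q = 1"
    using p q by auto
  have lift: "\<exists>S. S \<in> carrier E \<and> proj E S = a \<and> S \<otimes>\<^bsub>E\<^esub> S = incl E r"
    if a: "a \<in> A" and "lift_square a r E" for a r
  proof -
    obtain S where S: "S \<in> carrier E" "proj E S = a"
      by (rule lift_exists [of a]) (use a in auto)
    with that(2) have "S [^]\<^bsub>E\<^esub> (2::nat) = incl E r"
      by (simp add: lift_square_def lifts_def)
    with S show ?thesis
      by (metis square)
  qed
  note order_2 = order_2_section [where \<omega> = "CT_cocycle p q"]
  show ?thesis
  proof (cases rule: CT_subgroup_cases [OF A])
    case 1
    then show ?thesis
      using hom_one by (intro exI [of _ "\<lambda>_. \<one>\<^bsub>E\<^esub>"]) (simp add: normalised_section_def)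
  next
    case 2
    \<comment> \<open>The diagonal element is linear, so it has a lift with any wanted square;
      \<open>p * q\<close> is the value of \<open>CT_cocycle p q\<close> at this element paired with
      itself.\<close>
    obtain S where "S \<in> carrier E" "proj E S = (-1, -1)" "S \<otimes>\<^bsub>E\<^esub> S = incl E (p * q)"
      by (rule linear_normalised_lift [of "(-1, -1)" "p * q"]) (use 2 norm in \<open>auto simp: norm_mult\<close>)
    with 2 norm show ?thesis
      by (intro order_2 [of "(-1, -1)" S]) (auto simp: norm_mult CT_cocycle_def sign_cocycle_def)
  next
    case 3
    obtain S where "S \<in> carrier E" "proj E S = T_bar" "S \<otimes>\<^bsub>E\<^esub> S = incl E p"
      using lift [OF _ sq(1)] 3 by auto
    with 3 norm show ?thesis
      by (intro order_2 [of T_bar S]) (auto simp: CT_cocycle_def sign_cocycle_def T_bar_def)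
  next
    case 4
    obtain S where "S \<in> carrier E" "proj E S = C_bar" "S \<otimes>\<^bsub>E\<^esub> S = incl E q"
      using lift [OF _ sq(2)] 4 by auto
    with 4 norm show ?thesis
      by (intro order_2 [of C_bar S]) (auto simp: CT_cocycle_def sign_cocycle_def C_bar_def)
  next
    case 5
    have full: "T_bar \<in> A" "C_bar \<in> A" "CT_group\<lparr>carrier := A\<rparr> = CT_group"
      using 5 by (auto simp: T_bar_def C_bar_def)
    obtain T where T: "T \<in> carrier E" "proj E T = T_bar" "T \<otimes>\<^bsub>E\<^esub> T = incl E p"
      using lift [OF full(1) sq(1)] by auto
    obtain C\<^sub>0 where "C\<^sub>0 \<in> carrier E" "proj E C\<^sub>0 = C_bar"
      by (rule lift_exists [of C_bar]) (use full(2) in simp)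
    then obtain C where C: "C \<in> carrier E" "proj E C = C_bar" "T \<otimes>\<^bsub>E\<^esub> C = C \<otimes>\<^bsub>E\<^esub> T"
      by (rule commuting_lift [OF T(1,2), rotated]) (simp_all add: T_bar_def C_bar_def)
    \<comment> \<open>Replacing \<open>C\<^sub>0\<close> by a lift that commutes with
      \<open>T\<close> is harmless, because all lifts of \<open>C_bar\<close> have square
      \<open>incl E q\<close>.\<close>
    have "C \<otimes>\<^bsub>E\<^esub> C = incl E q"
      using C sq(2) by (simp add: lift_square_def lifts_def square)
    with T C p q show ?thesis
      using CT_section_full [of phi_CT E p q T C] phi_twisted_extension_axioms
      unfolding full(3) by blast
  qed
qed

section \<open>Isomorphism detected by the signs of squares\<close>

lemma standard_extension_iso_iff:
  assumes A: "subgroup A CT_group" and E: "standard_extension A E" and F: "standard_extension A F"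
    and p: "p \<in> {1, -1}" and q: "q \<in> {1, -1}"
    and sq: "lift_square T_bar p E" "lift_square C_bar q E"
  shows "extension_iso E F \<longleftrightarrow> lift_square T_bar p F \<and> lift_square C_bar q F"
proof
  assume "lift_square T_bar p F \<and> lift_square C_bar q F"
  then obtain s t where "normalised_section (CT_cocycle p q) (CT_group\<lparr>carrier := A\<rparr>) E s"
    "normalised_section (CT_cocycle p q) (CT_group\<lparr>carrier := A\<rparr>) F t"
    using standard_section [OF E A p q sq] standard_section [OF F A p q] by blast
  with E F p q show "extension_iso E F"
    unfolding standard_extension_def
    by (intro extension_iso_if_same_cocycle) (auto simp: norm_CT_cocycle)
next
  assume "extension_iso E F"
  moreover have "cmod p = 1" "cmod q = 1"
    using p q by auto
  ultimately show "lift_square T_bar p F \<and> lift_square C_bar q F"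
    using E F sq unfolding standard_extension_def by (blast intro: lift_square_iso)
qed

text \<open>There are no lifts outside the quotient. This lets a single statement with both signs
  \<open>p\<close> and \<open>q\<close> cover all five subgroups.\<close>

lemma lift_square_trivial:
  assumes "standard_extension A E" "a \<notin> A"
  shows "lift_square a p E"
proof -
  interpret phi_twisted_extension "CT_group\<lparr>carrier := A\<rparr>" phi_CT E
    using assms by (simp add: standard_extension_def)
  have "lifts E a = {}"
    using assms(2) hom_closed by (auto simp: lifts_def)
  then show ?thesis
    by (simp add: lift_square_def)
qed

lemma standard_lift_square_unique:
  assumes E: "standard_extension A E" and a: "a \<in> {T_bar, C_bar}" "a \<in> A"
  shows "\<exists>!p \<in> {1, -1}. lift_square a p E"
proof -
  interpret phi_twisted_extension "CT_group\<lparr>carrier := A\<rparr>" phi_CT E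
    using E by (simp add: standard_extension_def)
  obtain p where p: "p \<in> {1, -1}" "\<And>S. S \<in> lifts E a \<Longrightarrow> S [^]\<^bsub>E\<^esub> (2::nat) = incl E p"
    by (rule antilinear_square [of a]) (use a in \<open>auto simp: T_bar_def C_bar_def\<close>)
  show ?thesis
  proof (rule ex1I [of _ p])
    show "p \<in> {1, -1} \<and> lift_square a p E"
      using p by (auto simp: lift_square_def)
    fix q assume "q \<in> {1, -1} \<and> lift_square a q E"
    with p a show "q = p"
      by (intro lift_square_unique [of a q p]) (auto simp: lift_square_def)
  qed
qed

lemma standard_lift_square_exists:
  assumes "standard_extension A E" "a \<in> {T_bar, C_bar}"
  obtains p where "p \<in> {1, -1}" "lift_square a p E"
proof (cases "a \<in> A")
  case True
  with assms that show ?thesis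
    using standard_lift_square_unique by metis
next
  case False
  \<comment> \<open>For \<open>a\<close> outside \<open>A\<close> every value qualifies; 1 is a
    default.\<close>
  with assms that [of 1] show ?thesis
    by (simp add: lift_square_trivial)
qed

text \<open>All lifts of \<open>a\<close> share one square, so a single lift decides. This passes
  from the invariant to the individual lifts that the theorem speaks of.\<close>

lemma standard_lift_square_iff:
  assumes E: "standard_extension A E" and a: "a \<in> {T_bar, C_bar}"
    and S: "S \<in> lifts E a" and p: "p \<in> {1, -1}"
  shows "lift_square a p E \<longleftrightarrow> S [^]\<^bsub>E\<^esub> (2::nat) = incl E p"
proof
  show "S [^]\<^bsub>E\<^esub> (2::nat) = incl E p" if "lift_square a p E"
    using that S by (simp add: lift_square_def)
  interpret phi_twisted_extension "CT_group\<lparr>carrier := A\<rparr>" phi_CT E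
    using E by (simp add: standard_extension_def)
  obtain q where q: "q \<in> {1, -1}" "lift_square a q E"
    using E a by (rule standard_lift_square_exists)
  assume "S [^]\<^bsub>E\<^esub> (2::nat) = incl E p"
  then have "incl E p = incl E q"
    using q(2) S by (simp add: lift_square_def)
  moreover have "cmod p = 1" "cmod q = 1"
    using p q by auto
  ultimately show "lift_square a p E"
    using q(2) by (simp add: incl_inj)
qed

text \<open>A sign is determined by whether it equals 1, so agreement on that at the generators
  lying in \<open>A\<close> is equality of all the signs that the extensions carry.\<close>

lemma standard_extension_iso_iff_squares:
  assumes A: "subgroup A CT_group" and E: "standard_extension A E" and F: "standard_extension A F"
  shows "extension_iso E F \<longleftrightarrow>
    (\<forall>a \<in> {T_bar, C_bar} \<inter> A. lift_square a 1 E \<longleftrightarrow> lift_square a 1 F)"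
proof -
  obtain p q where p: "p \<in> {1, -1}" "lift_square T_bar p E" and q: "q \<in> {1, -1}" "lift_square C_bar q E"
    using standard_lift_square_exists [OF E] by (metis insertI1 insertI2)
  \<comment> \<open>For \<open>a\<close> in \<open>A\<close> the sign exists and is unique in both
    extensions; for \<open>a\<close> outside \<open>A\<close> both sides of the equivalence are
    trivially true.\<close>
  have "lift_square a r F \<longleftrightarrow> (a \<in> A \<longrightarrow> (lift_square a 1 E \<longleftrightarrow> lift_square a 1 F))"
    if a: "a \<in> {T_bar, C_bar}" and r: "r \<in> {1, -1}" "lift_square a r E" for a r
  proof (cases "a \<in> A")
    case True
    with standard_lift_square_unique [OF E a] standard_lift_square_unique [OF F a] r
    show ?thesis by (metis insertE insertI1 singletonD)
  next
    case False
    with F show ?thesis by (simp add: lift_square_trivial)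
  qed
  note square = this [of T_bar, OF _ p] this [of C_bar, OF _ q]
  show ?thesis
    unfolding standard_extension_iso_iff [OF A E F p(1) q(1) p(2) q(2)]
    using square by blast
qed

section \<open>Counting the isomorphism classes for each subgroup\<close>

lemma symmetry_classes_by_invariant:
  fixes Q :: "'i \<Rightarrow> (complex \<times> int \<times> int, int \<times> int) circle_extension \<Rightarrow> bool"
  assumes "\<And>i. i \<in> I \<Longrightarrow> \<exists>E. standard_extension A E \<and> Q i E"
    and "\<And>E. standard_extension A E \<Longrightarrow> \<exists>!i \<in> I. Q i E"
    and "\<And>i E F. \<lbrakk>i \<in> I; standard_extension A E; standard_extension A F; Q i E\<rbrakk>
      \<Longrightarrow> extension_iso E F \<longleftrightarrow> Q i F"
  shows "card (symmetry_classes A) = card I"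
    "\<forall>i \<in> I. \<exists>!K \<in> symmetry_classes A. \<forall>E \<in> K. Q i E"
  using quotient_by_invariant [of I "{E. standard_extension A E}" Q extension_iso] assms
  by (simp_all add: symmetry_classes_def)

text \<open>This serves the trivial and the diagonal subgroup: without \<open>T_bar\<close> and
  \<open>C_bar\<close> no sign is attached to an extension, so the criterion for isomorphism is
  vacuous.\<close>

lemma linear_subgroup_classification:
  assumes A: "subgroup A CT_group" and "T_bar \<notin> A" "C_bar \<notin> A"
  shows "card (symmetry_classes A) = 1"
    and "standard_extension A E \<Longrightarrow> standard_extension A F \<Longrightarrow> extension_iso E F"
proof -
  have iso: "extension_iso E F" if "standard_extension A E" "standard_extension A F"
    for E :: "('g, int \<times> int) circle_extension" and F :: "('h, int \<times> int) circle_extension"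
    using standard_extension_iso_iff_squares [OF A that] assms(2,3) by auto
  then show "standard_extension A E \<Longrightarrow> standard_extension A F \<Longrightarrow> extension_iso E F" .
  \<comment> \<open>The invariant is constant, with the one-point set as its range; a model shows
    that the class exists.\<close>
  have "card (symmetry_classes A) = card {()}"
    using standard_CT_model [OF A, of 1 1] standard_extension_iso_iff_squares [OF A] assms(2,3)
    by (intro symmetry_classes_by_invariant(1) [where Q = "\<lambda>_ _. True"]) auto
  then show "card (symmetry_classes A) = 1" by simp
qed

text \<open>The unordered pair in the hypothesis lets the lemma serve both two-element subgroups
  with an antilinear element; the sign at \<open>a\<close> is the complete invariant.\<close>

lemma one_antilinear_generator_classification:
  assumes A: "subgroup A CT_group" and ab: "{a, b} = {T_bar, C_bar}" "a \<in> A" "b \<notin> A"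
  shows "card (symmetry_classes A) = 2"
    and "\<forall>s \<in> {1, -1}. \<exists>!K \<in> symmetry_classes A. \<forall>E \<in> K. \<forall>S \<in> lifts E a. S [^]\<^bsub>E\<^esub> (2::nat) = incl E s"
    and "standard_extension A E \<Longrightarrow> S \<in> lifts E a \<Longrightarrow> S [^]\<^bsub>E\<^esub> (2::nat) \<in> {incl E 1, incl E (-1)}"
    and "standard_extension A E \<Longrightarrow> standard_extension A F \<Longrightarrow> S \<in> lifts E a \<Longrightarrow> S' \<in> lifts F a \<Longrightarrow>
      extension_iso E F \<longleftrightarrow> (S [^]\<^bsub>E\<^esub> (2::nat) = incl E 1 \<longleftrightarrow> S' [^]\<^bsub>F\<^esub> (2::nat) = incl F 1)"
proof -
  have a: "a \<in> {T_bar, C_bar}" and inter: "{T_bar, C_bar} \<inter> A = {a}"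
    using ab by auto
  \<comment> \<open>The model with both parameters equal to \<open>s\<close> has sign
    \<open>s\<close> at \<open>a\<close>, whichever of the two generators \<open>a\<close>
    is.\<close>
  have ex: "\<exists>E :: (complex \<times> int \<times> int, int \<times> int) circle_extension.
      standard_extension A E \<and> lift_square a s E" if "s \<in> {1, -1}" for s
    using standard_CT_model [OF A that that] CT_model_lift_square [OF A that that] a by blast
  have iso: "extension_iso E F \<longleftrightarrow> lift_square a s F"
    if "s \<in> {1, -1}" "standard_extension A E" "standard_extension A F" "lift_square a s E"
    for s and E F :: "(complex \<times> int \<times> int, int \<times> int) circle_extension"
    using standard_extension_iso_iff_squares [OF A that(2,3)] that(1,4)
      standard_lift_square_unique [OF that(2) a ab(2)] standard_lift_square_unique [OF that(3) a ab(2)]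
    unfolding inter by (metis insertE insertI1 singletonD)
  have "card (symmetry_classes A) = card {1, -1 :: complex}"
    by (rule symmetry_classes_by_invariant(1) [where Q = "lift_square a"])
      (assumption | rule ex standard_lift_square_unique [OF _ a ab(2)] iso)+
  then show "card (symmetry_classes A) = 2" by simp
  have "\<forall>s \<in> {1, -1}. \<exists>!K \<in> symmetry_classes A. \<forall>E \<in> K. lift_square a s E"
    by (rule symmetry_classes_by_invariant(2) [where Q = "lift_square a"])
      (assumption | rule ex standard_lift_square_unique [OF _ a ab(2)] iso)+
  then show "\<forall>s \<in> {1, -1}. \<exists>!K \<in> symmetry_classes A. \<forall>E \<in> K. \<forall>S \<in> lifts E a. S [^]\<^bsub>E\<^esub> (2::nat) = incl E s"
    unfolding lift_square_def .
  show "S [^]\<^bsub>E\<^esub> (2::nat) \<in> {incl E 1, incl E (-1)}" if "standard_extension A E" "S \<in> lifts E a"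
    using standard_lift_square_exists [OF that(1) a] that(2) by (auto simp: lift_square_def)
  show "extension_iso E F \<longleftrightarrow> (S [^]\<^bsub>E\<^esub> (2::nat) = incl E 1 \<longleftrightarrow> S' [^]\<^bsub>F\<^esub> (2::nat) = incl F 1)"
    if "standard_extension A E" "standard_extension A F" "S \<in> lifts E a" "S' \<in> lifts F a"
    using standard_extension_iso_iff_squares [OF A that(1,2)]
      standard_lift_square_iff [OF that(1) a that(3), of 1] standard_lift_square_iff [OF that(2) a that(4), of 1]
    unfolding inter by simp
qed

lemma full_group_classification:
  shows "card (symmetry_classes (carrier CT_group)) = 4"
    and "\<forall>s \<in> {1, -1}. \<forall>s' \<in> {1, -1}. \<exists>!K \<in> symmetry_classes (carrier CT_group).
      \<forall>E \<in> K. \<forall>T \<in> lifts E T_bar. \<forall>C \<in> lifts E C_bar.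
        T [^]\<^bsub>E\<^esub> (2::nat) = incl E s \<and> C [^]\<^bsub>E\<^esub> (2::nat) = incl E s'"
    and "standard_extension (carrier CT_group) E \<Longrightarrow> a \<in> {T_bar, C_bar} \<Longrightarrow> S \<in> lifts E a \<Longrightarrow>
      S [^]\<^bsub>E\<^esub> (2::nat) \<in> {incl E 1, incl E (-1)}"
    and "\<lbrakk>standard_extension (carrier CT_group) E; standard_extension (carrier CT_group) F;
        T \<in> lifts E T_bar; C \<in> lifts E C_bar; T' \<in> lifts F T_bar; C' \<in> lifts F C_bar\<rbrakk> \<Longrightarrow>
      extension_iso E F \<longleftrightarrow>
        (T [^]\<^bsub>E\<^esub> (2::nat) = incl E 1 \<longleftrightarrow> T' [^]\<^bsub>F\<^esub> (2::nat) = incl F 1) \<and>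
        (C [^]\<^bsub>E\<^esub> (2::nat) = incl E 1 \<longleftrightarrow> C' [^]\<^bsub>F\<^esub> (2::nat) = incl F 1)"
proof -
  let ?A = "carrier CT_group"
  note A = CT_subgroups(5)
  have T: "T_bar \<in> ?A" and C: "C_bar \<in> ?A"
    by (auto simp: T_bar_def C_bar_def)
  then have inter: "{T_bar, C_bar} \<inter> ?A = {T_bar, C_bar}"
    by auto
  \<comment> \<open>\<open>Q\<close> copies the wording of the theorem, where the quantifiers over
    \<open>T\<close> and \<open>C\<close> are joint, so that the conclusion about classes can be
    read off by unfolding.\<close>
  define Q where "Q = (\<lambda>(s, s') (E :: (complex \<times> int \<times> int, int \<times> int) circle_extension).
    \<forall>T \<in> lifts E T_bar. \<forall>C \<in> lifts E C_bar.
      T [^]\<^bsub>E\<^esub> (2::nat) = incl E s \<and> C [^]\<^bsub>E\<^esub> (2::nat) = incl E s')"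
  have Q_iff: "Q (s, s') E \<longleftrightarrow> lift_square T_bar s E \<and> lift_square C_bar s' E"
    if E: "standard_extension ?A E" for s s' E
  proof -
    interpret phi_twisted_extension "CT_group\<lparr>carrier := ?A\<rparr>" phi_CT E
      using E by (simp add: standard_extension_def)
    \<comment> \<open>Nonemptiness is what separates the joint condition: if one generator had no
      lifts, nothing would be said about the other.\<close>
    have "lifts E T_bar \<noteq> {}" "lifts E C_bar \<noteq> {}"
      using lifts_nonempty T C by simp_all
    then show ?thesis
      by (auto simp: Q_def lift_square_def)
  qed
  let ?I = "{1, -1 :: complex} \<times> {1, -1 :: complex}"
  have ex: "\<exists>E. standard_extension ?A E \<and> Q i E" if i_in: "i \<in> ?I" for i
  proof -
    obtain s s' where i: "i = (s, s')" and s: "s \<in> {1, -1}" "s' \<in> {1, -1}"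
      using i_in by blast
    show ?thesis
      using standard_CT_model [OF A s] CT_model_lift_square [OF A s] Q_iff i by blast
  qed
  have unique: "\<exists>!i \<in> ?I. Q i E" if E: "standard_extension ?A E" for E
  proof -
    obtain s s' where s: "s \<in> {1, -1}" "lift_square T_bar s E" and s': "s' \<in> {1, -1}" "lift_square C_bar s' E"
      using standard_lift_square_exists [OF E] by (metis insertI1 insertI2)
    show ?thesis
    proof (rule ex1I [of _ "(s, s')"])
      show "(s, s') \<in> ?I \<and> Q (s, s') E"
        using s s' Q_iff [OF E] by blast
      fix i assume i: "i \<in> ?I \<and> Q i E"
      then obtain r r' where "i = (r, r')" "r \<in> {1, -1}" "r' \<in> {1, -1}"
        "lift_square T_bar r E" "lift_square C_bar r' E"
        using Q_iff [OF E] by blast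
      moreover from this s s' have "r = s" "r' = s'"
        using standard_lift_square_unique [OF E _ T] standard_lift_square_unique [OF E _ C]
        by (metis insertI1, metis insertI1 insertI2)
      ultimately show "i = (s, s')" by simp
    qed
  qed
  have iso: "extension_iso E F \<longleftrightarrow> Q i F"
    if i_in: "i \<in> ?I" and E: "standard_extension ?A E" and F: "standard_extension ?A F" and Q: "Q i E" for i E F
  proof -
    obtain s s' where i: "i = (s, s')" and s: "s \<in> {1, -1}" "s' \<in> {1, -1}"
      using i_in by blast
    show ?thesis
      using standard_extension_iso_iff [OF A E F s] Q Q_iff [OF E] Q_iff [OF F] i by blast
  qed
  have "card (symmetry_classes ?A) = card ?I"
    by (rule symmetry_classes_by_invariant(1) [where Q = Q]) (assumption | rule ex unique iso)+
  then show "card (symmetry_classes ?A) = 4"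
    by (simp add: card_cartesian_product del: CT_group_simps)
  have *: "\<forall>i \<in> ?I. \<exists>!K \<in> symmetry_classes ?A. \<forall>E \<in> K. Q i E"
    by (rule symmetry_classes_by_invariant(2) [where Q = Q]) (assumption | rule ex unique iso)+
  show "\<forall>s \<in> {1, -1}. \<forall>s' \<in> {1, -1}. \<exists>!K \<in> symmetry_classes ?A.
      \<forall>E \<in> K. \<forall>T \<in> lifts E T_bar. \<forall>C \<in> lifts E C_bar.
        T [^]\<^bsub>E\<^esub> (2::nat) = incl E s \<and> C [^]\<^bsub>E\<^esub> (2::nat) = incl E s'"
  proof (intro ballI)
    fix s s' :: complex assume "s \<in> {1, -1}" "s' \<in> {1, -1}"
    then have "(s, s') \<in> ?I" by (rule SigmaI)
    from bspec [OF * this] show "\<exists>!K \<in> symmetry_classes ?A.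
      \<forall>E \<in> K. \<forall>T \<in> lifts E T_bar. \<forall>C \<in> lifts E C_bar.
        T [^]\<^bsub>E\<^esub> (2::nat) = incl E s \<and> C [^]\<^bsub>E\<^esub> (2::nat) = incl E s'"
      unfolding Q_def prod.case .
  qed
  show "S [^]\<^bsub>E\<^esub> (2::nat) \<in> {incl E 1, incl E (-1)}"
    if "standard_extension ?A E" "a \<in> {T_bar, C_bar}" "S \<in> lifts E a"
    using standard_lift_square_exists [OF that(1,2)] that(3) by (auto simp: lift_square_def)
  show "extension_iso E F \<longleftrightarrow>
      (T [^]\<^bsub>E\<^esub> (2::nat) = incl E 1 \<longleftrightarrow> T' [^]\<^bsub>F\<^esub> (2::nat) = incl F 1) \<and>
      (C [^]\<^bsub>E\<^esub> (2::nat) = incl E 1 \<longleftrightarrow> C' [^]\<^bsub>F\<^esub> (2::nat) = incl F 1)"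
    if "standard_extension ?A E" "standard_extension ?A F"
      "T \<in> lifts E T_bar" "C \<in> lifts E C_bar" "T' \<in> lifts F T_bar" "C' \<in> lifts F C_bar"
    using standard_extension_iso_iff_squares [OF A that(1,2)]
      standard_lift_square_iff [OF that(1) _ that(3), of 1] standard_lift_square_iff [OF that(2) _ that(5), of 1]
      standard_lift_square_iff [OF that(1) _ that(4), of 1] standard_lift_square_iff [OF that(2) _ that(6), of 1]
    unfolding inter by simp
qed

text \<open>Classes are counted on one fixed type, while the comparisons hold for extensions on
  arbitrary types \<open>'g\<close> and \<open>'h\<close>. Squares in two different groups cannot be
  equated, so agreement of signs is expressed by both squares being the image of 1 or
  neither.\<close>

theorem proposition6p4:
  shows "(card (symmetry_classes {(1, 1)}) = 1 \<and>
      (\<forall>(E :: ('g, int \<times> int) circle_extension) (F :: ('h, int \<times> int) circle_extension).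
        standard_extension {(1, 1)} E \<longrightarrow> standard_extension {(1, 1)} F \<longrightarrow> extension_iso E F)) \<and>
    (card (symmetry_classes {(1, 1), (-1, -1)}) = 1 \<and>
      (\<forall>(E :: ('g, int \<times> int) circle_extension) (F :: ('h, int \<times> int) circle_extension).
        standard_extension {(1, 1), (-1, -1)} E \<longrightarrow> standard_extension {(1, 1), (-1, -1)} F \<longrightarrow> extension_iso E F)) \<and>
    (card (symmetry_classes ({1, -1} \<times> {1})) = 2 \<and>
      (\<forall>s \<in> {1, -1}. \<exists>!K \<in> symmetry_classes ({1, -1} \<times> {1}).
        \<forall>E \<in> K. \<forall>T \<in> lifts E T_bar. T [^]\<^bsub>E\<^esub> (2::nat) = incl E s) \<and>
      (\<forall>E :: ('g, int \<times> int) circle_extension. standard_extension ({1, -1} \<times> {1}) E \<longrightarrow>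
        (\<forall>T \<in> lifts E T_bar. T [^]\<^bsub>E\<^esub> (2::nat) \<in> {incl E 1, incl E (-1)})) \<and>
      (\<forall>(E :: ('g, int \<times> int) circle_extension) (F :: ('h, int \<times> int) circle_extension).
        standard_extension ({1, -1} \<times> {1}) E \<longrightarrow> standard_extension ({1, -1} \<times> {1}) F \<longrightarrow>
        (\<forall>T \<in> lifts E T_bar. \<forall>T' \<in> lifts F T_bar.
          extension_iso E F \<longleftrightarrow>
          (T [^]\<^bsub>E\<^esub> (2::nat) = incl E 1 \<longleftrightarrow> T' [^]\<^bsub>F\<^esub> (2::nat) = incl F 1)))) \<and>
    (card (symmetry_classes ({1} \<times> {1, -1})) = 2 \<and>
      (\<forall>s \<in> {1, -1}. \<exists>!K \<in> symmetry_classes ({1} \<times> {1, -1}).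
        \<forall>E \<in> K. \<forall>C \<in> lifts E C_bar. C [^]\<^bsub>E\<^esub> (2::nat) = incl E s) \<and>
      (\<forall>E :: ('g, int \<times> int) circle_extension. standard_extension ({1} \<times> {1, -1}) E \<longrightarrow>
        (\<forall>C \<in> lifts E C_bar. C [^]\<^bsub>E\<^esub> (2::nat) \<in> {incl E 1, incl E (-1)})) \<and>
      (\<forall>(E :: ('g, int \<times> int) circle_extension) (F :: ('h, int \<times> int) circle_extension).
        standard_extension ({1} \<times> {1, -1}) E \<longrightarrow> standard_extension ({1} \<times> {1, -1}) F \<longrightarrow>
        (\<forall>C \<in> lifts E C_bar. \<forall>C' \<in> lifts F C_bar.
          extension_iso E F \<longleftrightarrow>
          (C [^]\<^bsub>E\<^esub> (2::nat) = incl E 1 \<longleftrightarrow> C' [^]\<^bsub>F\<^esub> (2::nat) = incl F 1)))) \<and>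
    (card (symmetry_classes (carrier CT_group)) = 4 \<and>
      (\<forall>s \<in> {1, -1}. \<forall>s' \<in> {1, -1}. \<exists>!K \<in> symmetry_classes (carrier CT_group).
        \<forall>E \<in> K. \<forall>T \<in> lifts E T_bar. \<forall>C \<in> lifts E C_bar.
          T [^]\<^bsub>E\<^esub> (2::nat) = incl E s \<and> C [^]\<^bsub>E\<^esub> (2::nat) = incl E s') \<and>
      (\<forall>E :: ('g, int \<times> int) circle_extension. standard_extension (carrier CT_group) E \<longrightarrow>
        (\<forall>T \<in> lifts E T_bar. T [^]\<^bsub>E\<^esub> (2::nat) \<in> {incl E 1, incl E (-1)}) \<and>
        (\<forall>C \<in> lifts E C_bar. C [^]\<^bsub>E\<^esub> (2::nat) \<in> {incl E 1, incl E (-1)})) \<and>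
      (\<forall>(E :: ('g, int \<times> int) circle_extension) (F :: ('h, int \<times> int) circle_extension).
        standard_extension (carrier CT_group) E \<longrightarrow> standard_extension (carrier CT_group) F \<longrightarrow>
        (\<forall>T \<in> lifts E T_bar. \<forall>C \<in> lifts E C_bar.
         \<forall>T' \<in> lifts F T_bar. \<forall>C' \<in> lifts F C_bar.
          extension_iso E F \<longleftrightarrow>
          (T [^]\<^bsub>E\<^esub> (2::nat) = incl E 1 \<longleftrightarrow> T' [^]\<^bsub>F\<^esub> (2::nat) = incl F 1) \<and>
          (C [^]\<^bsub>E\<^esub> (2::nat) = incl E 1 \<longleftrightarrow> C' [^]\<^bsub>F\<^esub> (2::nat) = incl F 1))))"
proof -
  \<comment> \<open>\<open>carrier CT_group\<close> has to stay folded so that the goals match the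
    statements for the full group.\<close>
  note [simp del] = CT_group_simps(1)
  have notin: "T_bar \<notin> {(1, 1)}" "C_bar \<notin> {(1, 1)}" "T_bar \<notin> {(1, 1), (-1, -1)}" "C_bar \<notin> {(1, 1), (-1, -1)}"
    "C_bar \<notin> {1, -1} \<times> {1}" "T_bar \<notin> {1} \<times> {1, -1}"
    and mem: "T_bar \<in> {1, -1} \<times> {1}" "C_bar \<in> {1} \<times> {1, -1}"
    by (auto simp: T_bar_def C_bar_def)
  note i = linear_subgroup_classification [OF CT_subgroups(1) notin(1,2)]
  note ii = linear_subgroup_classification [OF CT_subgroups(2) notin(3,4)]
  note iii = one_antilinear_generator_classification [OF CT_subgroups(3) refl mem(1) notin(5)]
  \<comment> \<open>\<open>insert_commute\<close> supplies the unordered pair with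
    \<open>C_bar\<close> first.\<close>
  note iv = one_antilinear_generator_classification [OF CT_subgroups(4) insert_commute mem(2) notin(6)]
  note v = full_group_classification
  show ?thesis
    by (intro conjI ballI allI impI;
      (rule i ii iii iv v bspec [OF iii(2)] bspec [OF iv(2)] bspec [OF bspec [OF v(2)]];
        (assumption | simp)?))
qed

end
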